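(* Suppose there are no edge marks (equivalently, $\mathcal Y$ is a singleton). Then for every $\beta\ge0$ the functional $\mathfrak I_{\beta,\eta_1}:\mathcal P(\mathcal T_{*,1}[\mathcal X])\to[0,\infty]$ has the representation $$\mathfrak I_{\beta,\eta_1}(\mu)=\begin{cases}H(\mu_o\|\nu)&\text{if }\beta=0\text{ and }\mathbb E_\mu[\deg_{\mathbf T}(o)]=0,\\ H(\mu\|\hat\mu)+\frac\beta2H(\bar\mu^{1,o}\,\|\,\bar\mu^1\otimes\bar\mu^o)&\text{if }\beta>0,\ \mathbb E_\mu[\deg_{\mathbf T}(o)]=\beta,\ \bar\mu^{1,o}\text{ is symmetric and }\mu\ll\eta_1,\\ \infty&\text{otherwise.}\end{cases}$$
   Context: $\mathcal X$ is a nonempty finite set and $\nu\in\mathcal P(\mathcal X)$. $\mathcal T_{*,1}[\mathcal X]$ is the set of isomorphism classes of rooted trees of depth at most 1 (stars rooted at their center $o$) with marks $X_v\in\mathcal X$ on vertices. $N_o(\tau)$ is the set of neighbors of the root and $\deg_\tau(o)=|N_o(\tau)|$. $\mathcal P(\cdot)$ denotes probability measures; $\mu_o$ is the law of the root mark under $\mu$; $\mathbf T$ is a random tree with the indicated law; $H(\cdot\|\cdot)$ is relative entropy. $\eta_1\in\mathcal P(\mathcal T_{*,1}[\mathcal X])$ is the law of a star whose vertex marks are i.i.d. with law $\nu$, independent of the root degree (whose mean is finite, and positive when $\beta>0$). For $\mu$ with $0<\mathbb E_\mu[\deg_{\mathbf T}(o)]<\infty$, the size-biased law $\bar\mu$ is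 given by $\frac{d\bar\mu}{d\mu}(\tau)=\deg_\tau(o)/\mathbb E_\mu[\deg_{\mathbf T}(o)]$. Under $\bar\mu$ let $1$ be a uniformly random child of the root; $\bar\mu^{1,o}$ is the law of $(\mathbf X_1,\mathbf X_o)$ on $\mathcal X^2$, $\bar\mu^1$ and $\bar\mu^o$ are its first and second marginals, and $\bar\mu^{1|o}$ is the conditional law of $\mathbf X_1$ given $\mathbf X_o$. $\bar\eta_1^{1,o},\bar\eta_1^1,\bar\eta_1^{1|o}$ are defined in the same way from $\eta_1$. For $\mu\ll\eta_1$, the probability measures $\check\mu,\hat\mu$ are defined by $$\frac{d\check\mu}{d\eta_1}(\tau)=\prod_{v\in N_o(\tau)}\frac{d\bar\mu^1}{d\bar\eta_1^1}(X_v),\qquad\frac{d\hat\mu}{d\eta_1}(\tau)=\prod_{v\in N_o(\tau)}\frac{d\bar\mu^{1|o}}{d\bar\eta_1^{1|o}}(X_v\mid X_o)$$ (where the conditioning value has zero $\bar\mu$-probability, any version of the conditional law absolutely continuous with respect to $\bar\eta_1^{1|o}$ is fixed; the choice is inconsequential). The functional $\mathfrak I_{\beta,\eta_1}$ is defined by $$\mathfrak I_{\beta,\eta_1}(\mu)=\begin{cases}H(\mu_o\|\nu)&\text{if }\beta=0\text{ and }\mathbb E_\mu[\deg_{\mathbf T}(o)]=0,\\ \frac12[H(\mu\|\check\mu)+H(\mu\|\hat\mu)]&\text{if }\beta>0,\ \mathbb E_\mu[\deg_{\mathbf T}(o)]=\beta,\ \bar\mu^{1,o}\text{ symmetric and }\mu\ll\eta_1,\\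 \infty&\text{otherwise.}\end{cases}$$ *)

theory Defs
  imports "HOL-Probability.Probability"
begin

section \<open>Relative entropy\<close>

text \<open>
  \<open>rel_entropy M N\<close> is \<open>H(M \<parallel> N)\<close> in nats, for probability measures on the same
  measurable space.  Mind the order of the arguments of the library constants:
  \<^term>\<open>absolutely_continuous N M\<close> says that \<open>M\<close> is absolutely continuous with respect
  to \<open>N\<close>, and \<^term>\<open>KL_divergence b N M\<close> is the integral of
  \<open>log b (dM/dN)\<close> with respect to \<open>M\<close>.
  The library's \<^const>\<open>KL_divergence\<close> is a Bochner integral and hence \<open>0\<close> if the logarithm of
  the density is not integrable; as its negative part always is integrable, the true
  value is then \<open>\<infinity>\<close>.
\<close>

definition rel_entropy :: "'a measure \<Rightarrow> 'a measure \<Rightarrow> ereal" where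
  "rel_entropy M N =
     (if absolutely_continuous N M \<and> integrable M (entropy_density (exp 1) N M)
      then ereal (KL_divergence (exp 1) N M) else \<infinity>)"


section \<open>Marked stars\<close>

text \<open>
  An isomorphism class of (locally finite) rooted trees of depth at most 1 with marked
  vertices is determined by the mark of the root and the multiset of the marks of its
  children; lemma \<open>star_of_eq_iff\<close> below confirms that this is exactly the
  quotient by root- and mark-preserving isomorphism, and lemma \<open>star_of_surj\<close> that every
  value of the type is such a class.
\<close>

datatype 'x star = Star (root_mark: 'x) (child_marks: "'x multiset")

definition star_of :: "'x \<Rightarrow> 'v set \<Rightarrow> ('v \<Rightarrow> 'x) \<Rightarrow> 'x star" where
  "star_of x V X = Star x (image_mset X (mset_set V))"

lemma star_of_eq_iff:
  fixes V :: "'v set" and W :: "'w set"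
  assumes "finite V" "finite W"
  shows "star_of x V X = star_of y W Y \<longleftrightarrow>
           x = y \<and> (\<exists>f. bij_betw f V W \<and> (\<forall>v\<in>V. Y (f v) = X v))"
proof -
  have "(\<exists>f. bij_betw f V W \<and> (\<forall>v\<in>V. Y (f v) = X v))"
    if "image_mset X (mset_set V) = image_mset Y (mset_set W)"
    using assms(1) that assms(2)
  proof (induction V arbitrary: W rule: finite_induct)
    case empty
    then have "W = {}" by (simp add: mset_set_empty_iff)
    then show ?case by (auto simp: bij_betw_def)
  next
    case (insert v V)
    have "X v \<in># image_mset Y (mset_set W)"
      using insert by (metis finite_set_mset_mset_set finite_insert image_eqI insertI1 set_image_mset)
    then obtain w where w: "w \<in> W" "Y w = X v" using insert.prems by auto
    have "mset_set W = add_mset w (mset_set (W - {w}))"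
      using w insert.prems by (simp add: mset_set.remove)
    then have "image_mset X (mset_set V) = image_mset Y (mset_set (W - {w}))"
      using insert w by simp
    then obtain f where f: "bij_betw f V (W - {w})" "\<forall>u\<in>V. Y (f u) = X u"
      using insert by blast
    let ?g = "f(v := w)"
    have "bij_betw ?g V (W - {w})"
      using f(1) insert.hyps by (subst bij_betw_cong[where g = f]) auto
    then have "bij_betw ?g (insert v V) (insert w (W - {w}))"
      using insert.hyps by (auto simp: bij_betw_def inj_on_insert)
    then have "bij_betw ?g (insert v V) W"
      using w by (simp add: insert_absorb)
    moreover have "\<forall>u\<in>insert v V. Y (?g u) = X u" using f w by auto
    ultimately show ?case by blast
  qed
  moreover have "image_mset X (mset_set V) = image_mset Y (mset_set W)"
    if f: "bij_betw f V W" "\<forall>v\<in>V. Y (f v) = X v" for f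
  proof -
    have "mset_set W = image_mset f (mset_set V)"
      using f(1) by (simp add: bij_betw_def image_mset_mset_set)
    then show ?thesis
      using f assms by (auto simp: multiset.map_comp intro!: image_mset_cong)
  qed
  ultimately show ?thesis by (auto simp: star_of_def)
qed

lemma star_of_surj:
  obtains x and V :: "nat set" and X where "finite V" "\<tau> = star_of x V X"
proof -
  obtain xs where xs: "mset xs = child_marks \<tau>" using ex_mset by blast
  have "\<tau> = star_of (root_mark \<tau>) {..<length xs} ((!) xs)"
    using mset_map[of "(!) xs" "[0..<length xs]"]
    by (simp add: star_of_def map_nth xs lessThan_atLeast0 mset_upt star.expand)
  then show ?thesis using that by blast
qed

definition root_degree :: "'x star \<Rightarrow> nat" where
  "root_degree \<tau> = size (child_marks \<tau>)"

definition mean_degree :: "'x star pmf \<Rightarrow> ennreal" where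
  "mean_degree \<mu> = (\<integral>\<^sup>+ \<tau>. of_nat (root_degree \<tau>) \<partial>measure_pmf \<mu>)"

text \<open>The law of a star whose degree has law \<open>p\<close> and whose vertex marks are i.i.d. with
  law \<open>\<nu>\<close>, independent of the degree.\<close>

definition iid_star_law :: "'x pmf \<Rightarrow> nat pmf \<Rightarrow> 'x star pmf" where
  "iid_star_law \<nu> p = do {
     n \<leftarrow> p;
     x \<leftarrow> \<nu>;
     ys \<leftarrow> replicate_pmf n \<nu>;
     return_pmf (Star x (mset ys)) }"


section \<open>Size-biased laws\<close>

text \<open>Only meaningful if the mean degree of \<open>\<mu>\<close> is positive and finite, which is the
  only case in which it is used below.\<close>

definition size_biased :: "'x star pmf \<Rightarrow> 'x star pmf" where
  "size_biased \<mu> =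
     embed_pmf (\<lambda>\<tau>. real (root_degree \<tau>) / enn2real (mean_degree \<mu>) * pmf \<mu> \<tau>)"

lemma pmf_size_biased:
  assumes "0 < mean_degree \<mu>" "mean_degree \<mu> < \<infinity>"
  shows "pmf (size_biased \<mu>) \<tau> = real (root_degree \<tau>) / enn2real (mean_degree \<mu>) * pmf \<mu> \<tau>"
  unfolding size_biased_def
proof (rule pmf_embed_pmf)
  let ?m = "enn2real (mean_degree \<mu>)"
  have m: "?m > 0" "ennreal ?m = mean_degree \<mu>"
    using assms by (auto simp: enn2real_positive_iff)
  have "(\<integral>\<^sup>+ \<tau>. ennreal (real (root_degree \<tau>) / ?m * pmf \<mu> \<tau>) \<partial>count_space UNIV)
      = (\<integral>\<^sup>+ \<tau>. ennreal (pmf \<mu> \<tau>) * (of_nat (root_degree \<tau>) / ennreal ?m) \<partial>count_space UNIV)"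
    using m(1) by (intro nn_integral_cong)
      (simp add: ennreal_mult divide_ennreal[symmetric] ennreal_of_nat_eq_real_of_nat mult.commute
         ennreal_times_divide)
  also have "\<dots> = (\<integral>\<^sup>+ \<tau>. of_nat (root_degree \<tau>) / ennreal ?m \<partial>measure_pmf \<mu>)"
    by (simp add: nn_integral_measure_pmf)
  also have "\<dots> = mean_degree \<mu> / ennreal ?m"
    by (simp add: mean_degree_def nn_integral_divide)
  also have "\<dots> = 1"
    using m assms by (simp add: ennreal_divide_self)
  finally show "(\<integral>\<^sup>+ \<tau>. ennreal (real (root_degree \<tau>) / ?m * pmf \<mu> \<tau>) \<partial>count_space UNIV) = 1" .
qed simp

text \<open>The law of \<open>(X\<^sub>1, X\<^sub>o)\<close> under the size-biased law.  A uniformly random child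
  has mark law \<^term>\<open>pmf_of_multiset (child_marks \<tau>)\<close>; the degree is almost surely positive.\<close>

definition edge_law :: "'x star pmf \<Rightarrow> ('x \<times> 'x) pmf" where
  "edge_law \<mu> = do {
     \<tau> \<leftarrow> size_biased \<mu>;
     x \<leftarrow> pmf_of_multiset (child_marks \<tau>);
     return_pmf (x, root_mark \<tau>) }"

abbreviation child_law :: "'x star pmf \<Rightarrow> 'x pmf" where
  "child_law \<mu> \<equiv> map_pmf fst (edge_law \<mu>)"

abbreviation root_law :: "'x star pmf \<Rightarrow> 'x pmf" where
  "root_law \<mu> \<equiv> map_pmf snd (edge_law \<mu>)"

definition symmetric_law :: "('x \<times> 'x) pmf \<Rightarrow> bool" where
  "symmetric_law J \<longleftrightarrow> map_pmf prod.swap J = J"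

text \<open>\<open>k\<close> is a version of the conditional law of the first component given the second one.\<close>

definition conditional_version :: "('x \<times> 'x) pmf \<Rightarrow> ('x \<Rightarrow> 'x pmf) \<Rightarrow> bool" where
  "conditional_version J k \<longleftrightarrow>
     (\<forall>y \<in> set_pmf (map_pmf snd J). k y = map_pmf fst (cond_pmf J {z. snd z = y}))"

text \<open>
  A choice \<open>\<kappa>\<close> of versions of the conditional laws: \<open>\<kappa> \<mu> y\<close> is the law of
  \<open>X\<^sub>1\<close> given \<open>X\<^sub>o = y\<close> under the size-biased law of \<open>\<mu>\<close>.  At conditioning values of probability zero
  the choice is free except for absolute continuity with respect to \<open>\<kappa> \<eta> y\<close>.
  The version for \<open>\<eta>\<close> itself is the instance \<open>\<mu> = \<eta>\<close>.
\<close>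

definition conditional_versions ::
    "'x star pmf \<Rightarrow> ('x star pmf \<Rightarrow> 'x \<Rightarrow> 'x pmf) \<Rightarrow> bool" where
  "conditional_versions \<eta> \<kappa> \<longleftrightarrow>
     (\<forall>\<mu>. 0 < mean_degree \<mu> \<and> mean_degree \<mu> < \<infinity> \<and> absolutely_continuous \<eta> \<mu> \<longrightarrow>
        conditional_version (edge_law \<mu>) (\<kappa> \<mu>) \<and>
        (\<forall>y. absolutely_continuous (\<kappa> \<eta> y) (\<kappa> \<mu> y)))"

lemma absolutely_continuous_pmf_iff:
  "absolutely_continuous (measure_pmf p) (measure_pmf q) \<longleftrightarrow> set_pmf q \<subseteq> set_pmf p"
proof
  assume "absolutely_continuous (measure_pmf p) (measure_pmf q)"
  moreover have "- set_pmf p \<in> null_sets (measure_pmf p)"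
    by (auto simp: null_sets_def measure_pmf.emeasure_eq_measure measure_pmf_zero_iff)
  ultimately have "emeasure (measure_pmf q) (- set_pmf p) = 0"
    by (auto simp: absolutely_continuous_def)
  then show "set_pmf q \<subseteq> set_pmf p"
    by (auto simp: measure_pmf.emeasure_eq_measure measure_pmf_zero_iff)
next
  assume "set_pmf q \<subseteq> set_pmf p"
  then show "absolutely_continuous (measure_pmf p) (measure_pmf q)"
    by (auto simp: absolutely_continuous_def null_sets_def measure_pmf.emeasure_eq_measure
        measure_pmf_zero_iff)
qed

lemma conditional_versions_exist:
  fixes \<eta> :: "'x star pmf"
  assumes \<eta>: "mean_degree \<eta> < \<infinity>"
  shows "\<exists>\<kappa>. conditional_versions \<eta> \<kappa>"
proof -
  define c where "c \<mu> y = map_pmf fst (cond_pmf (edge_law \<mu>) {z. snd z = y})" for \<mu> :: "'x star pmf" and y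
  define \<kappa> where "\<kappa> \<mu> y = (if y \<in> set_pmf (root_law \<mu>) then c \<mu> y else c \<eta> y)" for \<mu> y
  have "conditional_versions \<eta> \<kappa>"
    unfolding conditional_versions_def
  proof (intro allI impI conjI; elim conjE)
    fix \<mu> show "conditional_version (edge_law \<mu>) (\<kappa> \<mu>)"
      by (simp add: conditional_version_def \<kappa>_def c_def)
  next
    fix \<mu> y
    assume \<mu>: "0 < mean_degree \<mu>" "mean_degree \<mu> < \<infinity>" "absolutely_continuous \<eta> \<mu>"
    have sub: "set_pmf \<mu> \<subseteq> set_pmf \<eta>"
      using \<mu>(3) by (simp add: absolutely_continuous_pmf_iff)
    have "mean_degree \<eta> \<noteq> 0"
    proof
      assume "mean_degree \<eta> = 0"
      then have "\<forall>\<tau>\<in>set_pmf \<eta>. root_degree \<tau> = 0"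
        by (simp add: mean_degree_def nn_integral_0_iff_AE AE_measure_pmf_iff)
      then have "mean_degree \<mu> = 0"
        using sub by (auto simp: mean_degree_def nn_integral_0_iff_AE AE_measure_pmf_iff)
      then show False using \<mu>(1) by simp
    qed
    then have \<eta>0: "0 < mean_degree \<eta>" by (simp add: zero_less_iff_neq_zero)
    have sb: "set_pmf (size_biased \<mu>) \<subseteq> set_pmf (size_biased \<eta>)"
      using sub pmf_size_biased[OF \<mu>(1,2)] pmf_size_biased[OF \<eta>0 \<eta>] \<eta> \<eta>0
      by (auto simp: set_pmf_iff enn2real_eq_0_iff subset_iff)
    then have el: "set_pmf (edge_law \<mu>) \<subseteq> set_pmf (edge_law \<eta>)"
      by (auto simp: edge_law_def)
    have "set_pmf (c \<mu> y) \<subseteq> set_pmf (c \<eta> y)" if y: "y \<in> set_pmf (root_law \<mu>)"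
    proof -
      have ne: "set_pmf (edge_law \<mu>) \<inter> {z. snd z = y} \<noteq> {}" using y by auto
      with el have ne': "set_pmf (edge_law \<eta>) \<inter> {z. snd z = y} \<noteq> {}" by blast
      show ?thesis using el by (auto simp: c_def set_cond_pmf[OF ne] set_cond_pmf[OF ne'])
    qed
    then show "absolutely_continuous (\<kappa> \<eta> y) (\<kappa> \<mu> y)"
      by (auto simp: absolutely_continuous_pmf_iff \<kappa>_def)
  qed
  then show ?thesis by (rule exI[of _ \<kappa>])
qed


section \<open>The functional\<close>

definition check_law :: "'x star pmf \<Rightarrow> 'x star pmf \<Rightarrow> 'x star measure" where
  "check_law \<eta> \<mu> = density (measure_pmf \<eta>)
     (\<lambda>\<tau>. \<Prod>x\<in>#child_marks \<tau>. RN_deriv (child_law \<eta>) (child_law \<mu>) x)"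

definition hat_law ::
    "('x star pmf \<Rightarrow> 'x \<Rightarrow> 'x pmf) \<Rightarrow> 'x star pmf \<Rightarrow> 'x star pmf \<Rightarrow> 'x star measure" where
  "hat_law \<kappa> \<eta> \<mu> = density (measure_pmf \<eta>)
     (\<lambda>\<tau>. \<Prod>x\<in>#child_marks \<tau>. RN_deriv (\<kappa> \<eta> (root_mark \<tau>)) (\<kappa> \<mu> (root_mark \<tau>)) x)"

definition rate_functional ::
    "('x star pmf \<Rightarrow> 'x \<Rightarrow> 'x pmf) \<Rightarrow> 'x pmf \<Rightarrow> real \<Rightarrow> 'x star pmf \<Rightarrow> 'x star pmf \<Rightarrow> ereal" where
  "rate_functional \<kappa> \<nu> \<beta> \<eta> \<mu> =
     (if \<beta> = 0 \<and> mean_degree \<mu> = 0 then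
        rel_entropy (map_pmf root_mark \<mu>) \<nu>
      else if \<beta> > 0 \<and> mean_degree \<mu> = ennreal \<beta> \<and> symmetric_law (edge_law \<mu>)
              \<and> absolutely_continuous \<eta> \<mu> then
        (rel_entropy \<mu> (check_law \<eta> \<mu>) + rel_entropy \<mu> (hat_law \<kappa> \<eta> \<mu>)) / 2
      else \<infinity>)"

end

theory Submission
  imports Defs
begin

text \<open>
  On the support of \<open>\<mu>\<close> both \<open>d(check law)/d\<eta>\<^sub>1\<close> and \<open>d(hat law)/d\<eta>\<^sub>1\<close> are positive, and as the children
  under \<open>\<eta>\<^sub>1\<close> have law \<open>\<nu>\<close> independently of the root, the factors \<open>\<nu>(X\<^sub>v)\<close> cancel in their quotient.
  With \<open>J\<close> the edge law of \<open>\<mu>\<close> and \<open>J\<^sub>1, J\<^sub>o\<close> its marginals, the log-densities of \<open>\<mu>\<close> with respect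
  to the two measures thus differ by the sum of \<open>ln (J(X\<^sub>v, X\<^sub>o) / (J\<^sub>1(X\<^sub>v) J\<^sub>o(X\<^sub>o)))\<close> over the children
  \<open>v\<close>. This sum is bounded by a constant times the degree, hence integrable even if the relative
  entropies are infinite, and by the definition of size-biasing its mean is \<open>\<beta> H(J \<parallel> J\<^sub>1 \<otimes> J\<^sub>o)\<close>.
\<close>

section \<open>Nonnegativity of relative entropy\<close>

lemma rel_entropy_nonneg:
  assumes "prob_space M" "prob_space N" "sets M = sets N"
  shows "0 \<le> rel_entropy M N"
proof (cases "absolutely_continuous N M \<and> integrable M (entropy_density (exp 1) N M)")
  case True
  interpret M: prob_space M by fact
  interpret N: prob_space N by fact
  interpret N: information_space N "exp 1" by unfold_locales simp
  \<comment> \<open>\<open>N.KL_nonneg\<close> speaks of a real density with integrable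
    \<open>D * log D\<close>, so the extended-valued derivative is replaced by a real version
    \<open>D\<close>. The two agree almost everywhere under \<open>N\<close>, and by absolute
    continuity also under \<open>M\<close>.\<close>
  obtain D where D: "D \<in> borel_measurable N" "AE x in N. RN_deriv N M x = ennreal (D x)"
    "AE x in M. 0 < D x" "\<And>x. 0 \<le> D x"
    using N.real_RN_deriv[OF M.finite_measure_axioms] True assms(3) by metis
  have M: "M = density N (RN_deriv N M)"
    using True assms(3) by (subst N.density_RN_deriv) auto
  also have "\<dots> = density N D"
    using D by (intro density_cong) auto
  finally have MD: "M = density N D" .
  have "AE x in M. entropy_density (exp 1) N M x = log (exp 1) (D x)"
    using absolutely_continuous_AE[OF assms(3) _ D(2)] True D(4)
    by (auto simp: entropy_density_def elim!: eventually_mono)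
  moreover have [measurable]: "D \<in> borel_measurable M" using D(1) assms(3) by (simp cong: measurable_cong_sets)
  moreover have "entropy_density (exp 1) N M \<in> borel_measurable M"
    using measurable_entropy_density[of "exp 1" N M] assms(3) by (simp cong: measurable_cong_sets)
  ultimately have "integrable M (\<lambda>x. log (exp 1) (D x))"
    using True by (subst integrable_cong_AE[where g = "entropy_density (exp 1) N M"]) auto
  then have "integrable N (\<lambda>x. D x * log (exp 1) (D x))"
    using D(1,4) by (subst (asm) MD, subst (asm) integrable_density) auto
  then have "0 \<le> KL_divergence (exp 1) N (density N D)"
    using D MD assms(1) by (intro N.KL_nonneg) auto
  then show ?thesis using True MD by (simp add: rel_entropy_def)
qed (auto simp: rel_entropy_def)

section \<open>Radon-Nikodym derivatives at atoms\<close>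

lemma ennreal_mult_eq_imp:
  assumes "ennreal a * R = ennreal b" "0 < a" "0 \<le> b"
  shows "R = ennreal (b / a)"
  using assms by (cases R) (auto simp: ennreal_mult[symmetric] ennreal_mult_top field_simps)

lemma emeasure_density_pmf_singleton:
  "emeasure (density (measure_pmf p) g) {x} = ennreal (pmf p x) * g x"
  by (simp add: emeasure_density nn_integral_cmult_indicator emeasure_pmf_single
      mult.commute)

text \<open>A derivative is fixed only almost everywhere, but each point of the support of
  \<open>q\<close> is an atom of finite positive mass of the tilted measure, so the value there is
  forced. As \<open>g\<close> may be infinite off that support, the tilted measure need not be
  sigma-finite; existence therefore comes from an explicit density \<open>f\<close>.\<close>

lemma RN_deriv_density_pmf:
  assumes sub: "set_pmf q \<subseteq> set_pmf p" and g: "\<And>x. x \<in> set_pmf q \<Longrightarrow> 0 < g x \<and> g x < top"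
  shows "density (density (measure_pmf p) g) (RN_deriv (density (measure_pmf p) g) (measure_pmf q))
           = measure_pmf q"
    and "x \<in> set_pmf q \<Longrightarrow>
      RN_deriv (density (measure_pmf p) g) (measure_pmf q) x = ennreal (pmf q x / (pmf p x * enn2real (g x)))"
proof -
  define f where "f x = ennreal (pmf q x / (pmf p x * enn2real (g x)))" for x
  \<comment> \<open>Off the support of \<open>q\<close> the numerator of \<open>f\<close> vanishes,
    and \<open>0\<close> times an infinite \<open>g x\<close> is \<open>0\<close>.\<close>
  have *: "ennreal (pmf p x) * (g x * f x) = ennreal (pmf q x)" for x
  proof (cases "x \<in> set_pmf q")
    case True
    then obtain r where r: "g x = ennreal r" "r > 0"
      using g[OF True] by (cases "g x") auto
    have "pmf p x > 0" using True sub by (auto simp: pmf_positive)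
    then show ?thesis using r by (simp add: f_def ennreal_mult[symmetric])
  qed (simp add: f_def set_pmf_iff)
  have "density (density (measure_pmf p) g) f = measure_pmf q"
    by (simp add: measure_pmf_eq_density density_density_eq * mult.assoc)
  then show dens: "density (density (measure_pmf p) g) (RN_deriv (density (measure_pmf p) g) (measure_pmf q))
           = measure_pmf q"
    by (intro RN_derivI[where f = f]) auto
  assume x: "x \<in> set_pmf q"
  then obtain r where r: "g x = ennreal r" "r > 0"
    using g[OF x] by (cases "g x") auto
  have px: "pmf p x > 0" using x sub by (auto simp: pmf_positive)
  let ?R = "RN_deriv (density (measure_pmf p) g) (measure_pmf q)"
  have "ennreal (pmf q x) = emeasure (density (density (measure_pmf p) g) ?R) {x}"
    by (simp add: dens emeasure_pmf_single)
  also have "\<dots> = ennreal (pmf p x) * g x * ?R x"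
    by (subst density_density_eq) (auto simp: emeasure_density_pmf_singleton mult.assoc)
  finally have "ennreal (pmf p x * enn2real (g x)) * ?R x = ennreal (pmf q x)"
    using r px by (simp add: ennreal_mult)
  then show "?R x = ennreal (pmf q x / (pmf p x * enn2real (g x)))"
    using r px by (intro ennreal_mult_eq_imp) auto
qed

lemma entropy_density_density_pmf:
  assumes sub: "set_pmf q \<subseteq> set_pmf p" and g: "\<And>x. x \<in> set_pmf q \<Longrightarrow> 0 < g x \<and> g x < top"
  shows "absolutely_continuous (density (measure_pmf p) g) (measure_pmf q)"
    and "x \<in> set_pmf q \<Longrightarrow> entropy_density (exp 1) (density (measure_pmf p) g) (measure_pmf q) x
           = ln (pmf q x / (pmf p x * enn2real (g x)))"
proof -
  show "absolutely_continuous (density (measure_pmf p) g) (measure_pmf q)"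
    using absolutely_continuousI_density[of "RN_deriv (density (measure_pmf p) g) (measure_pmf q)"
        "density (measure_pmf p) g"] RN_deriv_density_pmf(1)[OF sub g]
    by simp
  show "entropy_density (exp 1) (density (measure_pmf p) g) (measure_pmf q) x
           = ln (pmf q x / (pmf p x * enn2real (g x)))" if "x \<in> set_pmf q"
    using RN_deriv_density_pmf(2)[OF sub g that] by (simp add: entropy_density_def log_def)
qed

lemma RN_deriv_pmf:
  assumes sub: "set_pmf q \<subseteq> set_pmf p" and x: "x \<in> set_pmf p"
  shows "RN_deriv (measure_pmf p) (measure_pmf q) x = ennreal (pmf q x / pmf p x)"
proof -
  have px: "pmf p x > 0" using x by (simp add: pmf_positive)
  have "density (measure_pmf p) (RN_deriv (measure_pmf p) (measure_pmf q)) = measure_pmf q"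
    using sub by (intro measure_pmf.density_RN_deriv) (auto simp: absolutely_continuous_pmf_iff)
  then have "ennreal (pmf p x) * RN_deriv (measure_pmf p) (measure_pmf q) x = ennreal (pmf q x)"
    by (metis emeasure_density_pmf_singleton emeasure_pmf_single)
  then show ?thesis using px by (intro ennreal_mult_eq_imp) auto
qed

section \<open>Sums and products over children, mass transport\<close>

lemma nn_integral_replicate_pmf_prod:
  "(\<integral>\<^sup>+ ys. (\<Prod>x\<in>#mset ys. f x) \<partial>replicate_pmf n p) = (\<integral>\<^sup>+ x. f x \<partial>measure_pmf p) ^ n"
  by (induction n) (simp_all add: nn_integral_cmult nn_integral_multc)

lemma nn_integral_replicate_pmf_sum:
  "(\<integral>\<^sup>+ ys. (\<Sum>x\<in>#mset ys. f x) \<partial>replicate_pmf n p) = of_nat n * (\<integral>\<^sup>+ x. f x \<partial>measure_pmf p)"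
  by (induction n) (simp_all add: nn_integral_add algebra_simps)

lemma sum_mset_eq_sum_count:
  fixes f :: "'a \<Rightarrow> 'b::comm_semiring_1"
  assumes "finite A" "set_mset M \<subseteq> A"
  shows "(\<Sum>x\<in>#M. f x) = (\<Sum>x\<in>A. of_nat (count M x) * f x)"
  using assms(2)
proof (induction M)
  case (add a M)
  have "(\<Sum>x\<in>A. of_nat (count (add_mset a M) x) * f x)
      = (\<Sum>x\<in>A. of_nat (count M x) * f x + (if x = a then f x else 0))"
    by (intro sum.cong) (auto simp: algebra_simps)
  then show ?case using add assms(1) by (simp add: sum.distrib add.commute)
qed simp

lemma nn_integral_pmf_of_multiset:
  assumes "M \<noteq> {#}"
  shows "of_nat (size M) * (\<integral>\<^sup>+ x. f x \<partial>pmf_of_multiset M) = (\<Sum>x\<in>#M. f x)"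
proof -
  have "of_nat (size M) * (\<integral>\<^sup>+ x. f x \<partial>pmf_of_multiset M)
    = (\<Sum>x\<in>set_mset M. of_nat (size M) * (f x * ennreal (real (count M x) / real (size M))))"
    using assms by (subst nn_integral_measure_pmf_finite) (auto simp: sum_distrib_left)
  also have "\<dots> = (\<Sum>x\<in>set_mset M. of_nat (count M x) * f x)"
  proof (intro sum.cong refl)
    fix x
    have "of_nat (size M) * (f x * ennreal (real (count M x) / real (size M)))
      = f x * (ennreal (size M) * ennreal (real (count M x) / real (size M)))"
      by (simp add: ennreal_of_nat_eq_real_of_nat ac_simps)
    also have "\<dots> = f x * ennreal (count M x)"
      using assms by (subst ennreal_mult[symmetric]) auto
    finally show "of_nat (size M) * (f x * ennreal (real (count M x) / real (size M))) = of_nat (count M x) * f x"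
      by (simp add: ennreal_of_nat_eq_real_of_nat ac_simps)
  qed
  also have "\<dots> = (\<Sum>x\<in>#M. f x)"
    by (rule sum_mset_eq_sum_count[symmetric]) auto
  finally show ?thesis .
qed


text \<open>The degree factor of the size-biased law cancels the reciprocal degree with which a
  uniform child is chosen, so every child is counted exactly once.\<close>

lemma mass_transport:
  assumes m: "0 < mean_degree \<mu>" "mean_degree \<mu> < \<infinity>"
  shows "mean_degree \<mu> * (\<integral>\<^sup>+ z. h z \<partial>edge_law \<mu>)
           = (\<integral>\<^sup>+ \<tau>. (\<Sum>x\<in>#child_marks \<tau>. h (x, root_mark \<tau>)) \<partial>measure_pmf \<mu>)"
proof -
  let ?m = "enn2real (mean_degree \<mu>)"
  define f where "f \<tau> = (\<integral>\<^sup>+ x. h (x, root_mark \<tau>) \<partial>pmf_of_multiset (child_marks \<tau>))" for \<tau>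
  have m': "?m > 0" "mean_degree \<mu> = ennreal ?m"
    using m by (auto simp: enn2real_positive_iff)
  have "mean_degree \<mu> * (\<integral>\<^sup>+ z. h z \<partial>edge_law \<mu>) = mean_degree \<mu> * (\<integral>\<^sup>+ \<tau>. f \<tau> \<partial>size_biased \<mu>)"
    by (simp add: edge_law_def f_def)
  also have "\<dots> = (\<integral>\<^sup>+ \<tau>. ennreal ?m * (ennreal (pmf (size_biased \<mu>) \<tau>) * f \<tau>) \<partial>count_space UNIV)"
    by (subst m'(2)) (simp add: nn_integral_measure_pmf nn_integral_cmult)
  also have "\<dots> = (\<integral>\<^sup>+ \<tau>. ennreal (pmf \<mu> \<tau>) * (of_nat (root_degree \<tau>) * f \<tau>) \<partial>count_space UNIV)"
  proof (intro nn_integral_cong)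
    fix \<tau>
    have "ennreal ?m * ennreal (pmf (size_biased \<mu>) \<tau>) = ennreal (pmf \<mu> \<tau>) * of_nat (root_degree \<tau>)"
      using m'(1) by (simp add: pmf_size_biased[OF m] ennreal_of_nat_eq_real_of_nat ennreal_mult[symmetric] mult.commute)
    then show "ennreal ?m * (ennreal (pmf (size_biased \<mu>) \<tau>) * f \<tau>)
        = ennreal (pmf \<mu> \<tau>) * (of_nat (root_degree \<tau>) * f \<tau>)"
      by (metis mult.assoc)
  qed
  also have "\<dots> = (\<integral>\<^sup>+ \<tau>. of_nat (root_degree \<tau>) * f \<tau> \<partial>measure_pmf \<mu>)"
    by (simp add: nn_integral_measure_pmf)
  also have "\<dots> = (\<integral>\<^sup>+ \<tau>. (\<Sum>x\<in>#child_marks \<tau>. h (x, root_mark \<tau>)) \<partial>measure_pmf \<mu>)"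
  proof (intro nn_integral_cong)
    fix \<tau> :: "'a star"
    \<comment> \<open>For a childless star the factor \<open>0\<close> on the left removes the
      unspecified value of \<open>pmf_of_multiset {#}\<close>, and the sum on the right is
      empty.\<close>
    show "of_nat (root_degree \<tau>) * f \<tau> = (\<Sum>x\<in>#child_marks \<tau>. h (x, root_mark \<tau>))"
      by (cases "child_marks \<tau> = {#}") (simp_all add: root_degree_def f_def nn_integral_pmf_of_multiset)
  qed
  finally show ?thesis .
qed

lemma sum_mset_nonneg:
  fixes f :: "'a \<Rightarrow> 'b::ordered_comm_monoid_add"
  assumes "\<And>x. x \<in># M \<Longrightarrow> 0 \<le> f x"
  shows "0 \<le> (\<Sum>x\<in>#M. f x)"
  using assms by (induction M) auto

lemma ennreal_sum_mset:
  assumes "\<And>x. x \<in># M \<Longrightarrow> 0 \<le> f x"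
  shows "ennreal (\<Sum>x\<in>#M. f x) = (\<Sum>x\<in>#M. ennreal (f x))"
  using assms by (induction M) (auto simp: sum_mset_nonneg)

text \<open>The signed version of mass transport. Since there are finitely many marks,
  \<open>h\<close> is a finite combination of indicators of single pairs, and the nonnegative
  version gives integrability and mean of each indicator count \<open>?c z\<close>.\<close>

lemma has_bochner_integral_sum_edges:
  fixes \<mu> :: "'x::finite star pmf" and h :: "'x \<times> 'x \<Rightarrow> real"
  assumes m: "0 < mean_degree \<mu>" "mean_degree \<mu> < \<infinity>"
  shows "has_bochner_integral (measure_pmf \<mu>) (\<lambda>\<tau>. \<Sum>x\<in>#child_marks \<tau>. h (x, root_mark \<tau>))
           (enn2real (mean_degree \<mu>) * measure_pmf.expectation (edge_law \<mu>) h)"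
proof -
  let ?m = "enn2real (mean_degree \<mu>)"
  let ?c = "\<lambda>z \<tau>. \<Sum>x\<in>#child_marks \<tau>. indicat_real {z} (x, root_mark \<tau>)"
  have m': "mean_degree \<mu> = ennreal ?m" using m by simp
  have c: "has_bochner_integral (measure_pmf \<mu>) (?c z) (?m * pmf (edge_law \<mu>) z)" for z
  proof (rule has_bochner_integral_nn_integral)
    have "(\<integral>\<^sup>+ \<tau>. ennreal (?c z \<tau>) \<partial>measure_pmf \<mu>) = mean_degree \<mu> * (\<integral>\<^sup>+ w. indicator {z} w \<partial>edge_law \<mu>)"
      by (subst mass_transport[OF m]) (simp add: ennreal_sum_mset ennreal_indicator)
    also have "\<dots> = ennreal (?m * pmf (edge_law \<mu>) z)"
      by (subst m') (simp add: emeasure_pmf_single ennreal_mult)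
    finally show "(\<integral>\<^sup>+ \<tau>. ennreal (?c z \<tau>) \<partial>measure_pmf \<mu>) = ennreal (?m * pmf (edge_law \<mu>) z)" .
  qed (auto intro!: sum_mset_nonneg)
  have "(\<Sum>x\<in>#M. h (x, y)) = (\<Sum>z\<in>UNIV. h z * (\<Sum>x\<in>#M. indicat_real {z} (x, y)))" for M y
  proof (induction M)
    case (add a M)
    have "(\<Sum>z\<in>UNIV. h z * indicat_real {z} (a, y)) = h (a, y)"
      by (simp add: indicator_def if_distrib[of "\<lambda>t. _ * t"] cong: if_cong)
    with add show ?case by (simp add: distrib_left sum.distrib)
  qed simp
  moreover have "has_bochner_integral (measure_pmf \<mu>) (\<lambda>\<tau>. \<Sum>z\<in>UNIV. h z * ?c z \<tau>)
      (\<Sum>z\<in>UNIV. h z * (?m * pmf (edge_law \<mu>) z))"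
    by (intro has_bochner_integral_sum has_bochner_integral_mult_right c)
  moreover have "(\<Sum>z\<in>UNIV. h z * (?m * pmf (edge_law \<mu>) z)) = ?m * measure_pmf.expectation (edge_law \<mu>) h"
    by (subst integral_measure_pmf[of UNIV]) (simp_all add: sum_distrib_left ac_simps)
  ultimately show ?thesis by simp
qed

section \<open>Stars with i.i.d. marks and conditional laws\<close>

lemma nn_integral_iid_star_law:
  "(\<integral>\<^sup>+ \<tau>. f \<tau> \<partial>iid_star_law \<nu> p) =
     (\<integral>\<^sup>+ n. \<integral>\<^sup>+ x. \<integral>\<^sup>+ ys. f (Star x (mset ys)) \<partial>replicate_pmf n \<nu> \<partial>\<nu> \<partial>p)"
  by (simp add: iid_star_law_def)

lemma mean_degree_iid_star_law:
  "mean_degree (iid_star_law \<nu> p) = (\<integral>\<^sup>+ n. of_nat n \<partial>measure_pmf p)"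
proof -
  have "(\<integral>\<^sup>+ ys. of_nat (length ys) \<partial>replicate_pmf n \<nu>) = of_nat n" for n
    using nn_integral_replicate_pmf_sum[where f = "\<lambda>_. 1" and n = n and p = \<nu>] by simp
  then show ?thesis
    by (simp add: mean_degree_def nn_integral_iid_star_law root_degree_def)
qed

text \<open>Mass transport turns the sum over the children into the degree times an integral over
  two independent marks. The mean degree factors out and, being positive and finite,
  cancels.\<close>

lemma edge_law_iid_star_law:
  assumes m: "0 < mean_degree (iid_star_law \<nu> p)" "mean_degree (iid_star_law \<nu> p) < \<infinity>"
  shows "edge_law (iid_star_law \<nu> p) = pair_pmf \<nu> \<nu>"
proof (rule pmf_eqI)
  fix z :: "'a \<times> 'a"
  obtain a b where z: "z = (a, b)" by (cases z)
  let ?\<eta> = "iid_star_law \<nu> p"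
  have "mean_degree ?\<eta> * ennreal (pmf (edge_law ?\<eta>) z) = mean_degree ?\<eta> * (\<integral>\<^sup>+ w. indicator {z} w \<partial>edge_law ?\<eta>)"
    by (simp add: emeasure_pmf_single)
  also have "\<dots> = (\<integral>\<^sup>+ n. \<integral>\<^sup>+ y. of_nat n * (\<integral>\<^sup>+ x. indicator {z} (x, y) \<partial>\<nu>) \<partial>\<nu> \<partial>p)"
    unfolding mass_transport[OF m] by (simp add: nn_integral_iid_star_law nn_integral_replicate_pmf_sum)
  also have "\<dots> = mean_degree ?\<eta> * (\<integral>\<^sup>+ y. \<integral>\<^sup>+ x. indicator {z} (x, y) \<partial>\<nu> \<partial>\<nu>)"
    by (simp add: mean_degree_iid_star_law nn_integral_cmult nn_integral_multc)
  also have "(\<integral>\<^sup>+ y. \<integral>\<^sup>+ x. indicator {z} (x, y) \<partial>\<nu> \<partial>\<nu>) = (\<integral>\<^sup>+ y. \<integral>\<^sup>+ x. indicator {a} x * indicator {b} y \<partial>\<nu> \<partial>\<nu>)"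
    by (intro nn_integral_cong) (auto simp: z indicator_def)
  also have "\<dots> = ennreal (pmf \<nu> a * pmf \<nu> b)"
    by (simp add: nn_integral_multc nn_integral_cmult emeasure_pmf_single ennreal_mult)
  also have "\<dots> = ennreal (pmf (pair_pmf \<nu> \<nu>) z)"
    by (simp add: z pmf_pair)
  finally show "pmf (edge_law ?\<eta>) z = pmf (pair_pmf \<nu> \<nu>) z"
    using m by (auto simp: ennreal_mult_cancel_left)
qed

lemma pmf_conditional_version:
  assumes k: "conditional_version J k" and y: "y \<in> set_pmf (map_pmf snd J)"
  shows "pmf (k y) x = pmf J (x, y) / pmf (map_pmf snd J) y"
proof -
  have ne: "set_pmf J \<inter> {z. snd z = y} \<noteq> {}" using y by auto
  let ?C = "cond_pmf J {z. snd z = y}"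
  have "pmf (k y) x = measure ?C (fst -` {x})"
    using k y by (simp add: conditional_version_def pmf_map del: set_map_pmf)
  \<comment> \<open>Under \<open>?C\<close> the second coordinate is almost surely \<open>y\<close>,
    so fixing the first one fixes the pair.\<close>
  also have "\<dots> = measure ?C {(x, y)}"
    by (intro measure_pmf.finite_measure_eq_AE) (auto simp: AE_measure_pmf_iff set_cond_pmf[OF ne])
  also have "\<dots> = pmf J (x, y) / pmf (map_pmf snd J) y"
    by (simp add: measure_pmf_single pmf_cond[OF ne] pmf_map vimage_def)
  finally show ?thesis .
qed

text \<open>Given degree and root mark the children are independent, so the product integrates to a
  power of the integral of one factor. The assumption is confined to root marks in the support of
  \<open>\<nu>\<close> because only there is \<open>\<kappa> \<eta> y\<close> identified
  below.\<close>

lemma prob_space_density_iid_star_law: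
  assumes "\<And>y. y \<in> set_pmf \<nu> \<Longrightarrow> (\<integral>\<^sup>+ x. F y x \<partial>measure_pmf \<nu>) = 1"
  shows "prob_space (density (measure_pmf (iid_star_law \<nu> p)) (\<lambda>\<tau>. \<Prod>x\<in>#child_marks \<tau>. F (root_mark \<tau>) x))"
proof
  have "(\<integral>\<^sup>+ x. \<integral>\<^sup>+ ys. (\<Prod>a\<in>#mset ys. F x a) \<partial>replicate_pmf n \<nu> \<partial>\<nu>) = (\<integral>\<^sup>+ x. 1 \<partial>\<nu>)" for n
    by (intro nn_integral_cong_AE)
       (auto simp: AE_measure_pmf_iff assms nn_integral_replicate_pmf_prod)
  then show "emeasure (density (measure_pmf (iid_star_law \<nu> p)) (\<lambda>\<tau>. \<Prod>x\<in>#child_marks \<tau>. F (root_mark \<tau>) x))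
     (space (density (measure_pmf (iid_star_law \<nu> p)) (\<lambda>\<tau>. \<Prod>x\<in>#child_marks \<tau>. F (root_mark \<tau>) x))) = 1"
    by (simp add: emeasure_density nn_integral_iid_star_law)
qed

lemma nn_integral_RN_deriv_pmf:
  assumes "set_pmf q \<subseteq> set_pmf p"
  shows "(\<integral>\<^sup>+ x. RN_deriv (measure_pmf p) (measure_pmf q) x \<partial>measure_pmf p) = 1"
  using measure_pmf.RN_deriv_nn_integral[of p q "\<lambda>_. 1"] assms
  by (simp add: absolutely_continuous_pmf_iff)

section \<open>Formulas for relative entropy\<close>

lemma rel_entropy_pmf_finite:
  fixes p q :: "'a::finite pmf"
  assumes "set_pmf q \<subseteq> set_pmf p"
  shows "rel_entropy (measure_pmf q) (measure_pmf p)
     = ereal (measure_pmf.expectation q (\<lambda>x. ln (pmf q x / pmf p x)))"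
proof -
  have 1: "density (measure_pmf p) (\<lambda>_. 1) = measure_pmf p" by (rule density_1)
  have "entropy_density (exp 1) (measure_pmf p) (measure_pmf q) x = ln (pmf q x / pmf p x)"
    if "x \<in> set_pmf q" for x
    using entropy_density_density_pmf(2)[OF assms, of "\<lambda>_. 1" x] that by (simp add: 1)
  then have "measure_pmf.expectation q (entropy_density (exp 1) (measure_pmf p) (measure_pmf q))
     = measure_pmf.expectation q (\<lambda>x. ln (pmf q x / pmf p x))"
    by (intro integral_cong_AE) (auto simp: AE_measure_pmf_iff)
  \<comment> \<open>On a finite type every function is integrable with respect to a pmf, which
    excludes the infinite branch of \<open>rel_entropy\<close>.\<close>
  then show ?thesis
    using assms by (simp add: rel_entropy_def absolutely_continuous_pmf_iff KL_divergence_def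
        integrable_measure_pmf_finite)
qed

text \<open>Adding or subtracting the integrable \<open>L\<close> preserves integrability, so the
  two entropies are infinite together; otherwise linearity of the integral applies.\<close>

lemma rel_entropy_add:
  assumes ac: "absolutely_continuous N M" "absolutely_continuous N' M"
    and sets: "sets N = sets M" "sets N' = sets M"
    and ae: "AE x in M. entropy_density (exp 1) N' M x = entropy_density (exp 1) N M x + L x"
    and L: "has_bochner_integral M L l"
  shows "rel_entropy M N' = rel_entropy M N + ereal l"
proof -
  let ?D = "entropy_density (exp 1) N M" and ?D' = "entropy_density (exp 1) N' M"
  have [measurable]: "?D \<in> borel_measurable M" "?D' \<in> borel_measurable M" "L \<in> borel_measurable M"
    using measurable_entropy_density[of "exp 1" N M] measurable_entropy_density[of "exp 1" N' M] sets L
    by (auto simp: has_bochner_integral_iff cong: measurable_cong_sets)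
  have L': "integrable M L" "integral\<^sup>L M L = l" using L by (auto simp: has_bochner_integral_iff)
  have "integrable M ?D' \<longleftrightarrow> integrable M (\<lambda>x. ?D x + L x)"
    using ae by (intro integrable_cong_AE) auto
  also have "\<dots> \<longleftrightarrow> integrable M ?D"
    using L'(1) Bochner_Integration.integrable_diff[of M "\<lambda>x. ?D x + L x" L] by auto
  finally have iff: "integrable M ?D' \<longleftrightarrow> integrable M ?D" .
  have "integral\<^sup>L M ?D' = integral\<^sup>L M ?D + l" if "integrable M ?D"
  proof -
    have "integral\<^sup>L M ?D' = integral\<^sup>L M (\<lambda>x. ?D x + L x)"
      using ae by (intro integral_cong_AE) auto
    then show ?thesis using that L' by simp
  qed
  then show ?thesis using iff ac by (auto simp: rel_entropy_def KL_divergence_def)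
qed

section \<open>Support of the edge law and product densities\<close>

lemma set_pmf_edge_law:
  assumes m: "0 < mean_degree \<mu>" "mean_degree \<mu> < \<infinity>"
  shows "set_pmf (edge_law \<mu>) = {(x, root_mark \<tau>) | x \<tau>. \<tau> \<in> set_pmf \<mu> \<and> x \<in># child_marks \<tau>}"
proof -
  have "enn2real (mean_degree \<mu>) > 0" using m by (auto simp: enn2real_positive_iff)
  then have "set_pmf (size_biased \<mu>) = {\<tau> \<in> set_pmf \<mu>. child_marks \<tau> \<noteq> {#}}"
    by (auto simp: set_pmf_iff pmf_size_biased[OF m] root_degree_def)
  then show ?thesis
    by (fastforce simp: edge_law_def)
qed

text \<open>The exponential form makes the product visibly positive and finite, as the density
  lemmas require, and turns its logarithm into a sum over the children.\<close>

lemma prod_mset_ennreal_eq_exp: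
  assumes "\<And>x. x \<in># M \<Longrightarrow> F x = ennreal (c x)" "\<And>x. x \<in># M \<Longrightarrow> 0 < c x"
  shows "(\<Prod>x\<in>#M. F x) = ennreal (exp (\<Sum>x\<in>#M. ln (c x)))"
  using assms by (induction M) (auto simp: exp_add ennreal_mult less_imp_le)

lemma sum_mset_subtractf:
  fixes f g :: "'a \<Rightarrow> 'b::ab_group_add"
  shows "(\<Sum>x\<in>#M. f x - g x) = (\<Sum>x\<in>#M. f x) - (\<Sum>x\<in>#M. g x)"
  by (induction M) (auto simp: algebra_simps)

section \<open>Comparison of the check and hat laws\<close>

context
  fixes \<nu> :: "'x::finite pmf" and p :: "nat pmf" and \<eta> \<mu> :: "'x star pmf"
    and \<kappa> :: "'x star pmf \<Rightarrow> 'x \<Rightarrow> 'x pmf"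
  assumes \<eta>: "\<eta> = iid_star_law \<nu> p"
    and \<kappa>: "conditional_versions \<eta> \<kappa>"
    and m\<eta>: "0 < mean_degree \<eta>" "mean_degree \<eta> < \<infinity>"
    and m\<mu>: "0 < mean_degree \<mu>" "mean_degree \<mu> < \<infinity>"
    and ac: "absolutely_continuous \<eta> \<mu>"
begin

lemma edge_law_reference: "edge_law \<eta> = pair_pmf \<nu> \<nu>"
  using edge_law_iid_star_law m\<eta> by (simp add: \<eta>)

lemma child_law_reference: "child_law \<eta> = \<nu>"
  by (simp add: edge_law_reference map_fst_pair_pmf)

lemma set_pmf_subset_reference: "set_pmf \<mu> \<subseteq> set_pmf \<eta>"
  using ac by (simp add: absolutely_continuous_pmf_iff)

lemma set_pmf_edge_law_subset: "set_pmf (edge_law \<mu>) \<subseteq> set_pmf \<nu> \<times> set_pmf \<nu>"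
proof -
  have "set_pmf (edge_law \<mu>) \<subseteq> set_pmf (edge_law \<eta>)"
    using set_pmf_subset_reference by (auto simp: set_pmf_edge_law[OF m\<mu>] set_pmf_edge_law[OF m\<eta>])
  then show ?thesis by (simp add: edge_law_reference)
qed

text \<open>The reference law is an instance of \<open>\<mu>\<close> in
  \<open>conditional_versions\<close>. Its edge law is a product, so conditioning on the root mark
  changes nothing; off the support of \<open>\<nu>\<close> the version is not determined.\<close>

lemma conditional_reference:
  assumes "y \<in> set_pmf \<nu>"
  shows "\<kappa> \<eta> y = \<nu>"
proof (rule pmf_eqI)
  have "absolutely_continuous \<eta> \<eta>" by (simp add: absolutely_continuous_pmf_iff)
  then have "conditional_version (edge_law \<eta>) (\<kappa> \<eta>)"
    using \<kappa> m\<eta> by (simp add: conditional_versions_def)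
  then show "pmf (\<kappa> \<eta> y) x = pmf \<nu> x" for x
    using assms pmf_conditional_version[of "edge_law \<eta>" "\<kappa> \<eta>" y x]
    by (auto simp: edge_law_reference map_snd_pair_pmf pmf_pair set_pmf_iff simp del: set_map_pmf)
qed

text \<open>A mark in the support of \<open>\<nu>\<close> may have probability zero under
  \<open>root_law \<mu>\<close>. The absolute continuity clause of
  \<open>conditional_versions\<close> covers that case too.\<close>

lemma set_pmf_conditional_subset: "y \<in> set_pmf \<nu> \<Longrightarrow> set_pmf (\<kappa> \<mu> y) \<subseteq> set_pmf \<nu>"
  using \<kappa> m\<mu> ac conditional_reference[of y] unfolding conditional_versions_def
  by (metis absolutely_continuous_pmf_iff)

lemma set_pmf_child_law_subset: "set_pmf (child_law \<mu>) \<subseteq> set_pmf \<nu>"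
  using set_pmf_edge_law_subset by auto

text \<open>Each child contributes a factor of mean one under \<open>\<nu>\<close>. Total mass one
  is what the nonnegativity of the relative entropies rests on.\<close>

lemma prob_space_check_law: "prob_space (check_law \<eta> \<mu>)"
  unfolding check_law_def child_law_reference
  using prob_space_density_iid_star_law[where F = "\<lambda>_. RN_deriv \<nu> (child_law \<mu>)" and p = p]
    nn_integral_RN_deriv_pmf[OF set_pmf_child_law_subset]
  by (simp add: \<eta>)

lemma prob_space_hat_law: "prob_space (hat_law \<kappa> \<eta> \<mu>)"
proof -
  have "(\<integral>\<^sup>+ x. RN_deriv (\<kappa> \<eta> y) (\<kappa> \<mu> y) x \<partial>measure_pmf \<nu>) = 1" if "y \<in> set_pmf \<nu>" for y
    using that by (simp add: conditional_reference nn_integral_RN_deriv_pmf set_pmf_conditional_subset)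
  from prob_space_density_iid_star_law[OF this] show ?thesis
    unfolding hat_law_def by (simp add: \<eta>)
qed

lemma edge_of_star:
  assumes "\<tau> \<in> set_pmf \<mu>" "x \<in># child_marks \<tau>"
  shows "(x, root_mark \<tau>) \<in> set_pmf (edge_law \<mu>)"
  using assms by (auto simp: set_pmf_edge_law[OF m\<mu>])

lemma check_density_eq_exp:
  assumes \<tau>: "\<tau> \<in> set_pmf \<mu>"
  shows "(\<Prod>x\<in>#child_marks \<tau>. RN_deriv (child_law \<eta>) (child_law \<mu>) x)
    = ennreal (exp (\<Sum>x\<in>#child_marks \<tau>. ln (pmf (child_law \<mu>) x / pmf \<nu> x)))"
proof (rule prod_mset_ennreal_eq_exp)
  fix x assume x: "x \<in># child_marks \<tau>"
  have J: "(x, root_mark \<tau>) \<in> set_pmf (edge_law \<mu>)" using edge_of_star \<tau> x .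
  then have "x \<in> set_pmf \<nu>" "x \<in> set_pmf (child_law \<mu>)"
    using set_pmf_edge_law_subset by (auto intro!: image_eqI)
  then show "RN_deriv (child_law \<eta>) (child_law \<mu>) x = ennreal (pmf (child_law \<mu>) x / pmf \<nu> x)"
    "0 < pmf (child_law \<mu>) x / pmf \<nu> x"
    unfolding child_law_reference using set_pmf_child_law_subset
    by (simp_all add: RN_deriv_pmf pmf_positive del: set_map_pmf)
qed

text \<open>Any child of a star in the support of \<open>\<mu>\<close> forms with the root a pair of
  positive probability under the edge law. Hence the root mark is charged by
  \<open>root_law \<mu>\<close> and \<open>\<kappa> \<mu>\<close> is determined there; for a
  childless star the product is empty. The choice of version thus does not show on the support of
  \<open>\<mu>\<close>.\<close>

lemma hat_density_eq_exp:
  assumes \<tau>: "\<tau> \<in> set_pmf \<mu>"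
  shows "(\<Prod>x\<in>#child_marks \<tau>. RN_deriv (\<kappa> \<eta> (root_mark \<tau>)) (\<kappa> \<mu> (root_mark \<tau>)) x)
    = ennreal (exp (\<Sum>x\<in>#child_marks \<tau>.
        ln (pmf (edge_law \<mu>) (x, root_mark \<tau>) / pmf (root_law \<mu>) (root_mark \<tau>) / pmf \<nu> x)))"
proof (rule prod_mset_ennreal_eq_exp)
  fix x assume x: "x \<in># child_marks \<tau>"
  let ?y = "root_mark \<tau>"
  have J: "(x, ?y) \<in> set_pmf (edge_law \<mu>)" using edge_of_star \<tau> x .
  then have mem: "x \<in> set_pmf \<nu>" "?y \<in> set_pmf \<nu>" "?y \<in> set_pmf (root_law \<mu>)"
    using set_pmf_edge_law_subset by (auto intro!: image_eqI)
  have "conditional_version (edge_law \<mu>) (\<kappa> \<mu>)"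
    using \<kappa> m\<mu> ac by (simp add: conditional_versions_def)
  then show "RN_deriv (\<kappa> \<eta> ?y) (\<kappa> \<mu> ?y) x
      = ennreal (pmf (edge_law \<mu>) (x, ?y) / pmf (root_law \<mu>) ?y / pmf \<nu> x)"
    using mem RN_deriv_pmf[OF set_pmf_conditional_subset, of ?y x]
    by (simp add: conditional_reference pmf_conditional_version del: set_map_pmf)
  show "0 < pmf (edge_law \<mu>) (x, ?y) / pmf (root_law \<mu>) ?y / pmf \<nu> x"
    using mem J by (simp add: pmf_positive del: set_map_pmf)
qed

text \<open>Stated as a sum rather than a difference, so that it stays meaningful when both
  entropies are infinite.\<close>

lemma rel_entropy_check_law:
  "rel_entropy \<mu> (check_law \<eta> \<mu>) = rel_entropy \<mu> (hat_law \<kappa> \<eta> \<mu>)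
     + ereal (enn2real (mean_degree \<mu>)) * rel_entropy (edge_law \<mu>) (pair_pmf (child_law \<mu>) (root_law \<mu>))"
proof -
  let ?J = "edge_law \<mu>" and ?P = "pair_pmf (child_law \<mu>) (root_law \<mu>)"
  define h where "h z = ln (pmf ?J z / pmf ?P z)" for z
  define L where "L \<tau> = (\<Sum>x\<in>#child_marks \<tau>. h (x, root_mark \<tau>))" for \<tau>
  have "rel_entropy \<mu> (check_law \<eta> \<mu>) = rel_entropy \<mu> (hat_law \<kappa> \<eta> \<mu>)
     + ereal (enn2real (mean_degree \<mu>) * measure_pmf.expectation ?J h)"
  proof (rule rel_entropy_add)
    show "absolutely_continuous (hat_law \<kappa> \<eta> \<mu>) \<mu>" "absolutely_continuous (check_law \<eta> \<mu>) \<mu>"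
      unfolding hat_law_def check_law_def
      by (intro entropy_density_density_pmf(1) set_pmf_subset_reference; simp add: hat_density_eq_exp check_density_eq_exp)+
    show "has_bochner_integral (measure_pmf \<mu>) L (enn2real (mean_degree \<mu>) * measure_pmf.expectation ?J h)"
      unfolding L_def by (rule has_bochner_integral_sum_edges[OF m\<mu>])
    have "entropy_density (exp 1) (check_law \<eta> \<mu>) \<mu> \<tau> = entropy_density (exp 1) (hat_law \<kappa> \<eta> \<mu>) \<mu> \<tau> + L \<tau>"
      if \<tau>: "\<tau> \<in> set_pmf \<mu>" for \<tau>
    proof -
      let ?y = "root_mark \<tau>"
      let ?c = "\<lambda>x. pmf (child_law \<mu>) x / pmf \<nu> x"
      let ?d = "\<lambda>x. pmf ?J (x, ?y) / pmf (root_law \<mu>) ?y / pmf \<nu> x"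
      have pos: "pmf \<mu> \<tau> > 0" "pmf \<eta> \<tau> > 0"
        using \<tau> set_pmf_subset_reference by (auto simp: pmf_positive)
      \<comment> \<open>Both log-densities share the term
        \<open>ln (pmf \<mu> \<tau> / pmf \<eta> \<tau>)\<close>; only the exponent
        \<open>s\<close>, a sum over the children, differs.\<close>
      have ln: "ln (pmf \<mu> \<tau> / (pmf \<eta> \<tau> * exp s)) = ln (pmf \<mu> \<tau> / pmf \<eta> \<tau>) - s" for s
        using pos by (simp add: ln_div ln_mult)
      have "L \<tau> = (\<Sum>x\<in>#child_marks \<tau>. ln (?d x) - ln (?c x))"
        unfolding L_def
      proof (intro arg_cong[where f = sum_mset] image_mset_cong)
        fix x assume x: "x \<in># child_marks \<tau>"
        have J: "(x, ?y) \<in> set_pmf ?J" using edge_of_star \<tau> x .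
        then have "x \<in> set_pmf \<nu>" "x \<in> set_pmf (child_law \<mu>)" "?y \<in> set_pmf (root_law \<mu>)"
          using set_pmf_edge_law_subset by (auto intro!: image_eqI)
        then have "pmf \<nu> x > 0" "pmf (child_law \<mu>) x > 0" "pmf (root_law \<mu>) ?y > 0" "pmf ?J (x, ?y) > 0"
          using J by (simp_all add: pmf_positive del: set_map_pmf)
        then show "h (x, ?y) = ln (?d x) - ln (?c x)"
          by (simp add: h_def pmf_pair ln_div ln_mult)
      qed
      moreover have "entropy_density (exp 1) (check_law \<eta> \<mu>) \<mu> \<tau>
          = ln (pmf \<mu> \<tau> / pmf \<eta> \<tau>) - (\<Sum>x\<in>#child_marks \<tau>. ln (?c x))"
        unfolding check_law_def
        by (subst entropy_density_density_pmf(2)) (simp_all add: set_pmf_subset_reference check_density_eq_exp \<tau> ln)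
      moreover have "entropy_density (exp 1) (hat_law \<kappa> \<eta> \<mu>) \<mu> \<tau>
          = ln (pmf \<mu> \<tau> / pmf \<eta> \<tau>) - (\<Sum>x\<in>#child_marks \<tau>. ln (?d x))"
        unfolding hat_law_def
        by (subst entropy_density_density_pmf(2)) (simp_all add: set_pmf_subset_reference hat_density_eq_exp \<tau> ln)
      ultimately show ?thesis by (simp add: sum_mset_subtractf)
    qed
    then show "AE \<tau> in \<mu>. entropy_density (exp 1) (check_law \<eta> \<mu>) \<mu> \<tau>
        = entropy_density (exp 1) (hat_law \<kappa> \<eta> \<mu>) \<mu> \<tau> + L \<tau>"
      by (simp add: AE_measure_pmf_iff)
  qed (simp_all add: hat_law_def check_law_def)
  \<comment> \<open>A pair charged by \<open>?J\<close> has both coordinates charged by the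
    marginals, so \<open>?J\<close> is absolutely continuous with respect to
    \<open>?P\<close>.\<close>
  moreover have "rel_entropy ?J ?P = ereal (measure_pmf.expectation ?J h)"
    unfolding h_def by (intro rel_entropy_pmf_finite) (auto intro!: image_eqI)
  ultimately show ?thesis by simp
qed

end

section \<open>The representation of the rate functional\<close>

theorem corollary3p3:
  fixes \<nu> :: "'x::finite pmf" and p :: "nat pmf" and \<beta> :: real
    and \<eta>\<^sub>1 \<mu> :: "'x star pmf" and \<kappa> :: "'x star pmf \<Rightarrow> 'x \<Rightarrow> 'x pmf"
  assumes "\<beta> \<ge> 0"
    and "integrable (measure_pmf p) real"
    and "\<beta> > 0 \<Longrightarrow> measure_pmf.expectation p real > 0"
    and "\<eta>\<^sub>1 = iid_star_law \<nu> p"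
    and "conditional_versions \<eta>\<^sub>1 \<kappa>"
  shows "0 \<le> rate_functional \<kappa> \<nu> \<beta> \<eta>\<^sub>1 \<mu> \<and>
    rate_functional \<kappa> \<nu> \<beta> \<eta>\<^sub>1 \<mu> =
      (if \<beta> = 0 \<and> mean_degree \<mu> = 0 then
         rel_entropy (map_pmf root_mark \<mu>) \<nu>
       else if \<beta> > 0 \<and> mean_degree \<mu> = ennreal \<beta> \<and> symmetric_law (edge_law \<mu>)
               \<and> absolutely_continuous \<eta>\<^sub>1 \<mu> then
         rel_entropy \<mu> (hat_law \<kappa> \<eta>\<^sub>1 \<mu>)
         + ereal (\<beta> / 2) * rel_entropy (edge_law \<mu>) (pair_pmf (child_law \<mu>) (root_law \<mu>))
       else \<infinity>)"
proof (cases "\<beta> > 0 \<and> mean_degree \<mu> = ennreal \<beta> \<and> symmetric_law (edge_law \<mu>)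
    \<and> absolutely_continuous \<eta>\<^sub>1 \<mu>")
  case True
  have "mean_degree \<eta>\<^sub>1 = ennreal (measure_pmf.expectation p real)"
    unfolding assms(4) mean_degree_iid_star_law ennreal_of_nat_eq_real_of_nat
    by (intro nn_integral_eq_integral assms(2)) simp
  then have m\<eta>: "0 < mean_degree \<eta>\<^sub>1" "mean_degree \<eta>\<^sub>1 < \<infinity>" using assms(3) True by auto
  have m\<mu>: "0 < mean_degree \<mu>" "mean_degree \<mu> < \<infinity>" using True by auto
  note facts = assms(4,5) m\<eta> m\<mu> True[THEN conjunct2, THEN conjunct2, THEN conjunct2]
  let ?H = "rel_entropy \<mu> (hat_law \<kappa> \<eta>\<^sub>1 \<mu>)" and ?C = "rel_entropy \<mu> (check_law \<eta>\<^sub>1 \<mu>)"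
  let ?K = "rel_entropy (edge_law \<mu>) (pair_pmf (child_law \<mu>) (root_law \<mu>))"
  have H: "0 \<le> ?H" and C: "0 \<le> ?C"
    using prob_space_hat_law[OF facts] prob_space_check_law[OF facts]
    by (auto intro!: rel_entropy_nonneg measure_pmf.prob_space_axioms simp: hat_law_def check_law_def)
  \<comment> \<open>Since \<open>?K\<close> is finite, the identity can be checked by cases on
    \<open>?H\<close> alone: an infinite \<open>?H\<close> makes both sides infinite, and a finite
    one leaves real arithmetic.\<close>
  obtain k where k: "?K = ereal k"
    using rel_entropy_pmf_finite[of "edge_law \<mu>" "pair_pmf (child_law \<mu>) (root_law \<mu>)"]
    by (force intro!: image_eqI)
  have CH: "?C = ?H + ereal \<beta> * ?K"
    using rel_entropy_check_law[OF facts] True by simp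
  have "(?C + ?H) / 2 = ?H + ereal (\<beta> / 2) * ?K"
    using H unfolding CH k by (cases ?H) (auto simp: field_simps)
  moreover have "0 \<le> (?C + ?H) / 2"
    using H C by (cases ?H; cases ?C) auto
  ultimately show ?thesis using True by (simp add: rate_functional_def)
next
  case False
  \<comment> \<open>In the remaining branches the two expressions coincide literally, and only
    nonnegativity is left to show.\<close>
  have "0 \<le> rel_entropy (map_pmf root_mark \<mu>) \<nu>"
    by (intro rel_entropy_nonneg measure_pmf.prob_space_axioms) simp
  then show ?thesis using False by (auto simp: rate_functional_def)
qed

end
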